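(* Let $(z_k)_{k\in\mathbb{N}}$ be a sequence of pairwise distinct complex numbers with $|z_k|\to\infty$, let $f$ be a Weierstrass map whose simple zeros are the points $z_1,z_2,\ldots$, let $n\ge2$, let $S(f)=\{(z,w)\in\mathbb{C}^2: w^n=f(z)\}$ be the infinite superelliptic curve with its tame translation structure, and let $\mathbb{C}^{\star}=\mathbb{C}\setminus\{z_k:k\in\mathbb{N}\}$. Then the Veech group $\Gamma(\mathbb{C}^{\star})$ is a subgroup of $\Gamma(S(f))$.
   Context: Weierstrass map: for a sequence $(z_k)_{k\in\mathbb{N}}$ of distinct complex numbers with $|z_k|\to\infty$, a function $f(z)=h(z)z^{m}\prod_{k\ge 1,\,z_k\ne 0}\left(1-\frac{z}{z_k}\right)E_k(z)$, where $h$ is a zero-free entire function, $m=1$ if some $z_k=0$ and $m=0$ otherwise, and $E_k(z)=\exp\left[\sum_{s=1}^{d(k)}\frac1s\left(\frac{z}{z_k}\right)^s\right]$ with suitably large non-negative integers $d(k)$ (so that the product converges). Its zeros are simple and are exactly the points $z_k$. Translation structures: $\mathbb{C}^{\star}$ is a translation surface as an open subset of $\mathbb{C}$. Let $p_{\mathbf z}:S(f)\to\mathbb{C}$, $(z,w)\mapsto z$. The restriction $p_{\mathbf z}: S(f)\setminus\{(z_k,0):k\in\mathbb{N}\}\to\mathbb{C}^{\star}$ is an unramified covering of degree $n$, by which the translation structure of $\mathbb{C}^{\star}$ is pulled back; the cone points of $S(f)$ are exactly the points $(z_k,0)$. Veech group: identify $\mathbb{C}$ with $\mathbb{R}^2$.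 An affine diffeomorphism $T:S\to S$ of a translation surface is a homeomorphism sending cone points to cone points which in the local coordinates of the translation atlas is a real-affine map $z\mapsto A\cdot z+t$ with $A\in{\rm GL}(2,\mathbb{R})$, $t\in\mathbb{C}$. ${\rm Aff}_+(S)$ is the group of orientation preserving affine diffeomorphisms of $S$. The differential of $T\in{\rm Aff}_+(S)$ is a constant matrix $D(T)\in{\rm GL}_+(2,\mathbb{R})$ (the group of real $2\times2$ matrices with positive determinant), and $D:{\rm Aff}_+(S)\to{\rm GL}_+(2,\mathbb{R})$ is a group homomorphism whose image $\Gamma(S)$ is the Veech group of $S$. The group ${\rm Aff}_+(\mathbb{C}^{\star})$ consists of the orientation preserving affine diffeomorphisms of $\mathbb{C}$ permuting the points of $(z_k)_{k\in\mathbb{N}}$. *)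

theory Defs
  imports "HOL-Complex_Analysis.Complex_Analysis" "HOL-Algebra.Group"
begin

section \<open>Weierstrass maps\<close>

text \<open>
  The factor of the product at \<open>a\<close>, that is \<open>(1 - x/a) exp (\<Sum>s=1..d. (x/a)^s / s)\<close>;
  a vanishing \<open>a\<close> is omitted from the product.
\<close>
definition weierstrass_term :: "nat \<Rightarrow> complex \<Rightarrow> complex \<Rightarrow> complex" where
  "weierstrass_term d a x = (if a = 0 then 1 else weierstrass_factor d (x / a))"

text \<open>
  Convergence of a product of entire functions is locally uniform convergence; the
  \<^const>\<open>convergent_prod\<close> conjunct excludes products diverging to zero.
\<close>
definition weierstrass_map :: "(nat \<Rightarrow> complex) \<Rightarrow> (complex \<Rightarrow> complex) \<Rightarrow> bool" where
  "weierstrass_map z f \<longleftrightarrow>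
     (\<exists>(h :: complex \<Rightarrow> complex) (d :: nat \<Rightarrow> nat).
        h holomorphic_on UNIV \<and> (\<forall>x. h x \<noteq> 0) \<and>
        (\<forall>x. convergent_prod (\<lambda>k. weierstrass_term (d k) (z k) x)) \<and>
        (\<forall>K. compact K \<longrightarrow>
           uniform_limit K (\<lambda>N x. \<Prod>k<N. weierstrass_term (d k) (z k) x)
             (\<lambda>x. \<Prod>k. weierstrass_term (d k) (z k) x) sequentially) \<and>
        (\<forall>x. f x = h x * x ^ (if 0 \<in> range z then 1 else 0)
                   * (\<Prod>k. weierstrass_term (d k) (z k) x)))"


section \<open>Translation surfaces\<close>

text \<open>
  The topology is the subspace topology of \<open>points\<close>. The charts are defined on open sets
  of points that are not cone points. The atlas need not be maximal.
\<close>
record 'a translation_data =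
  points :: "'a set"
  cone_points :: "'a set"
  charts :: "('a set \<times> ('a \<Rightarrow> complex)) set"

definition regular_points :: "('a, 'm) translation_data_scheme \<Rightarrow> 'a set" where
  "regular_points S = points S - cone_points S"

definition translation_surface :: "('a::topological_space, 'm) translation_data_scheme \<Rightarrow> bool"
  where
  "translation_surface S \<longleftrightarrow>
     cone_points S \<subseteq> points S \<and>
     openin (top_of_set (points S)) (regular_points S) \<and>
     (\<forall>c\<in>cone_points S. \<exists>W. openin (top_of_set (points S)) W \<and> W \<inter> cone_points S = {c}) \<and>
     (\<Union>(U, \<phi>)\<in>charts S. U) = regular_points S \<and>
     (\<forall>(U, \<phi>)\<in>charts S. openin (top_of_set (regular_points S)) U \<and>
        open (\<phi> ` U) \<and> (\<exists>g. homeomorphism U (\<phi> ` U) \<phi> g)) \<and>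
     (\<forall>(U, \<phi>)\<in>charts S. \<forall>(V, \<psi>)\<in>charts S. \<forall>p\<in>U \<inter> V.
        \<exists>t W. openin (top_of_set U) W \<and> p \<in> W \<and> W \<subseteq> V \<and> (\<forall>q\<in>W. \<psi> q = \<phi> q + t))"

text \<open>The translation atlas on \<open>X\<close> pulled back from the atlas \<open>\<A>\<close> along \<open>p\<close>.\<close>
definition pullback_charts ::
  "'a::topological_space set \<Rightarrow> ('a \<Rightarrow> 'b) \<Rightarrow> ('b::topological_space set \<times> ('b \<Rightarrow> complex)) set
     \<Rightarrow> ('a set \<times> ('a \<Rightarrow> complex)) set" where
  "pullback_charts X p \<A> =
     {(U, \<phi> \<circ> p) | U V \<phi>. (V, \<phi>) \<in> \<A> \<and> openin (top_of_set X) U \<and>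
        openin (top_of_set V) (p ` U) \<and> (\<exists>g. homeomorphism U (p ` U) p g)}"

definition punctured_plane :: "(nat \<Rightarrow> complex) \<Rightarrow> complex translation_data" where
  "punctured_plane z =
     \<lparr>points = - range z, cone_points = {}, charts = {(- range z, \<lambda>x. x)}\<rparr>"

definition superelliptic_set :: "nat \<Rightarrow> (complex \<Rightarrow> complex) \<Rightarrow> (complex \<times> complex) set" where
  "superelliptic_set n f = {(x, w). w ^ n = f x}"

definition superelliptic_curve ::
  "nat \<Rightarrow> (nat \<Rightarrow> complex) \<Rightarrow> (complex \<Rightarrow> complex) \<Rightarrow> (complex \<times> complex) translation_data" where
  "superelliptic_curve n z f =
     \<lparr>points = superelliptic_set n f,
      cone_points = range (\<lambda>k. (z k, 0)),
      charts = pullback_charts (superelliptic_set n f - range (\<lambda>k. (z k, 0))) fst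
                 (charts (punctured_plane z))\<rparr>"


section \<open>Affine diffeomorphisms and Veech groups\<close>

text \<open>The action of a real matrix on \<open>\<complex> = \<real>\<^sup>2\<close>.\<close>
definition matrix_act :: "real^2^2 \<Rightarrow> complex \<Rightarrow> complex" where
  "matrix_act A x = Complex (A $ 1 $ 1 * Re x + A $ 1 $ 2 * Im x)
                            (A $ 2 $ 1 * Re x + A $ 2 $ 2 * Im x)"

definition has_differential_at ::
  "('a::topological_space, 'm) translation_data_scheme \<Rightarrow> ('a \<Rightarrow> 'a) \<Rightarrow> 'a \<Rightarrow> real^2^2 \<Rightarrow> bool"
  where
  "has_differential_at S T p A \<longleftrightarrow>
     (\<forall>(U, \<phi>)\<in>charts S. \<forall>(V, \<psi>)\<in>charts S. p \<in> U \<longrightarrow> T p \<in> V \<longrightarrow>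
        (\<exists>t W. openin (top_of_set U) W \<and> p \<in> W \<and> T ` W \<subseteq> V \<and>
           (\<forall>q\<in>W. \<psi> (T q) = matrix_act A (\<phi> q) + t)))"

text \<open>
  Only the values of \<open>T\<close> on \<open>points S\<close> matter. The inverse must be an affine diffeomorphism too,
  so the set of cone points is mapped onto itself.
\<close>
definition affine_diffeo ::
  "('a::topological_space, 'm) translation_data_scheme \<Rightarrow> ('a \<Rightarrow> 'a) \<Rightarrow> bool" where
  "affine_diffeo S T \<longleftrightarrow>
     (\<exists>g. homeomorphism (points S) (points S) T g) \<and>
     T ` cone_points S = cone_points S \<and>
     (\<forall>p\<in>regular_points S. \<exists>A. invertible A \<and> has_differential_at S T p A)"

definition orientation_preserving ::
  "('a::topological_space, 'm) translation_data_scheme \<Rightarrow> ('a \<Rightarrow> 'a) \<Rightarrow> bool" where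
  "orientation_preserving S T \<longleftrightarrow>
     (\<forall>p\<in>regular_points S. \<forall>A. has_differential_at S T p A \<longrightarrow> det A > 0)"

definition Aff_plus ::
  "('a::topological_space, 'm) translation_data_scheme \<Rightarrow> ('a \<Rightarrow> 'a) set" where
  "Aff_plus S = {T. affine_diffeo S T \<and> orientation_preserving S T}"

text \<open>The relation \<open>D(T) = A\<close>: the differential of \<open>T\<close> is the constant matrix \<open>A\<close>.\<close>
definition has_differential ::
  "('a::topological_space, 'm) translation_data_scheme \<Rightarrow> ('a \<Rightarrow> 'a) \<Rightarrow> real^2^2 \<Rightarrow> bool" where
  "has_differential S T A \<longleftrightarrow> (\<forall>p\<in>regular_points S. has_differential_at S T p A)"

definition GL2_plus :: "(real^2^2) monoid" where
  "GL2_plus = \<lparr>carrier = {A. det A > 0}, mult = (**), one = mat 1\<rparr>"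

definition veech_group ::
  "('a::topological_space, 'm) translation_data_scheme \<Rightarrow> (real^2^2) monoid" where
  "veech_group S = GL2_plus\<lparr>carrier := {A. \<exists>T\<in>Aff_plus S. has_differential S T A}\<rparr>"


section \<open>The two surfaces are translation surfaces\<close>

text \<open>
  These facts are not needed to state the theorem. They show that a Weierstrass map is entire with
  zero set \<open>range z\<close>, and that the charts of both surfaces do form translation atlases on the
  complement of the cone points.
\<close>

lemma finite_range_inter:
  fixes z :: "nat \<Rightarrow> complex"
  assumes "filterlim (\<lambda>k. norm (z k)) at_top sequentially"
  shows "finite (range z \<inter> cball 0 r)"
proof -
  have "eventually (\<lambda>k. norm (z k) > r) sequentially"
    using assms by (simp add: filterlim_at_top_dense)
  then obtain N where N: "\<And>k. k \<ge> N \<Longrightarrow> norm (z k) > r"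
    by (auto simp: eventually_sequentially)
  have "k < N" if "norm (z k) \<le> r" for k
    using N[of k] that by (meson leI not_less)
  then have "range z \<inter> cball 0 r \<subseteq> z ` {..<N}" by auto
  then show ?thesis by (rule finite_subset) auto
qed

lemma closed_discrete:
  fixes z :: "nat \<Rightarrow> complex"
  assumes "filterlim (\<lambda>k. norm (z k)) at_top sequentially" and A: "A \<subseteq> range z"
  shows "closed A"
proof -
  have "\<not> x islimpt A" for x
  proof
    assume "x islimpt A"
    then have "infinite (A \<inter> cball x 1)"
      using islimpt_eq_infinite_cball zero_less_one by blast
    moreover have "A \<inter> cball x 1 \<subseteq> range z \<inter> cball 0 (norm x + 1)"
    proof
      fix y assume y: "y \<in> A \<inter> cball x 1"
      have "norm y \<le> norm x + norm (y - x)" by (metis norm_triangle_sub)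
      with y A show "y \<in> range z \<inter> cball 0 (norm x + 1)"
        by (auto simp: dist_norm norm_minus_commute)
    qed
    ultimately show False
      using finite_range_inter[OF assms(1)] finite_subset by blast
  qed
  then show ?thesis by (simp add: closed_limpt)
qed

lemma weierstrass_map_zero_iff:
  assumes "weierstrass_map z f" shows "f x = 0 \<longleftrightarrow> x \<in> range z"
proof -
  from assms obtain h d where h: "\<And>x. h x \<noteq> 0"
    and c: "\<And>x. convergent_prod (\<lambda>k. weierstrass_term (d k) (z k) x)"
    and f: "\<And>x. f x = h x * x ^ (if 0 \<in> range z then 1 else 0)
                   * (\<Prod>k. weierstrass_term (d k) (z k) x)"
    unfolding weierstrass_map_def by blast
  have w: "weierstrass_term (d k) (z k) x = 0 \<longleftrightarrow> z k \<noteq> 0 \<and> x = z k" for k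
    by (auto simp: weierstrass_term_def weierstrass_factor_def field_simps)
  have "(\<Prod>k. weierstrass_term (d k) (z k) x) = 0 \<longleftrightarrow> (\<exists>k. weierstrass_term (d k) (z k) x = 0)"
    using has_prod_eq_0_iff[OF convergent_prod_has_prod[OF c[of x]]] by auto
  then show ?thesis unfolding f using h[of x] w by (auto simp: image_iff split: if_splits)
qed

lemma weierstrass_map_holomorphic:
  assumes "weierstrass_map z f" shows "f holomorphic_on UNIV"
proof -
  from assms obtain h d where h: "h holomorphic_on UNIV"
    and u: "\<And>K. compact K \<Longrightarrow> uniform_limit K (\<lambda>N x. \<Prod>k<N. weierstrass_term (d k) (z k) x)
             (\<lambda>x. \<Prod>k. weierstrass_term (d k) (z k) x) sequentially"
    and f: "\<And>x. f x = h x * x ^ (if 0 \<in> range z then 1 else 0)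
                   * (\<Prod>k. weierstrass_term (d k) (z k) x)"
    unfolding weierstrass_map_def by blast
  have w: "weierstrass_term a b holomorphic_on UNIV" for a b
    unfolding weierstrass_term_def[abs_def] by (cases "b = 0") (auto intro!: holomorphic_intros)
  have "(\<lambda>x. \<Prod>k. weierstrass_term (d k) (z k) x) holomorphic_on UNIV"
  proof (rule holomorphic_uniform_sequence[where f = "\<lambda>N x. \<Prod>k<N. weierstrass_term (d k) (z k) x"])
    show "(\<lambda>x. \<Prod>k<N. weierstrass_term (d k) (z k) x) holomorphic_on UNIV" for N
      by (intro holomorphic_intros w)
  qed (use u zero_less_one compact_cball in blast)+
  then have "(\<lambda>x. h x * x ^ (if 0 \<in> range z then 1 else 0)
                   * (\<Prod>k. weierstrass_term (d k) (z k) x)) holomorphic_on UNIV"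
    by (intro holomorphic_intros h) 
  then show ?thesis using f by (simp cong: holomorphic_cong)
qed

lemma translation_surface_punctured_plane:
  assumes "filterlim (\<lambda>k. norm (z k)) at_top sequentially"
  shows "translation_surface (punctured_plane z)"
proof -
  have "homeomorphism (- range z) (- range z) (\<lambda>x. x) (\<lambda>x. x)"
    by (rule homeomorphism_ident)
  moreover have "\<exists>t W. openin (top_of_set (- range z)) W \<and> p \<in> W \<and> W \<subseteq> - range z \<and>
      (\<forall>q\<in>W. q = q + t)" if "p \<in> - range z" for p
    using that by (intro exI[of _ 0] exI[of _ "- range z"]) auto
  ultimately show ?thesis
    using closed_discrete[OF assms order_refl]
    by (auto simp: translation_surface_def punctured_plane_def regular_points_def open_Compl)
qed

lemma translation_surface_superelliptic_curve:
  assumes z: "filterlim (\<lambda>k. norm (z k)) at_top sequentially"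
    and f: "weierstrass_map z f" and n: "n \<ge> 2"
  shows "translation_surface (superelliptic_curve n z f)"
proof -
  let ?C = "range (\<lambda>k. (z k, 0::complex))"
  let ?P = "superelliptic_set n f"
  let ?X = "?P - ?C"
  have C: "?C = range z \<times> {0}" by auto
  have opn: "open (- range z)" using closed_discrete[OF z order_refl] by (simp add: open_Compl)
  note f0 = weierstrass_map_zero_iff[OF f]
  have contf: "continuous_on UNIV f"
    by (rule holomorphic_on_imp_continuous_on[OF weierstrass_map_holomorphic[OF f]])
  have X: "?X = {(x, w). w ^ n = f x \<and> x \<notin> range z}"
    using f0 n by (auto simp: superelliptic_set_def C) (metis power_not_zero rangeI)
  have sub: "?C \<subseteq> ?P" using f0 n by (auto simp: superelliptic_set_def power_0_left)
  have op: "openin (top_of_set ?P) ?X"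
  proof -
    have "closed ?C" unfolding C by (intro closed_Times closed_discrete[OF z order_refl] closed_singleton)
    then show ?thesis by (metis Diff_eq open_Compl openin_open_Int)
  qed
  have disc: "\<exists>W. openin (top_of_set ?P) W \<and> W \<inter> ?C = {c}" if "c \<in> ?C" for c
  proof -
    from that obtain k where c: "c = (z k, 0)" by blast
    let ?A = "range z - {z k}"
    have "open ((- ?A) \<times> (UNIV::complex set))"
      by (intro open_Times open_Compl closed_discrete[OF z] open_UNIV) auto
    then have "openin (top_of_set ?P) (?P \<inter> (- ?A) \<times> UNIV)" by (rule openin_open_Int)
    moreover have "(?P \<inter> (- ?A) \<times> UNIV) \<inter> ?C = {c}" using sub by (auto simp: c)
    ultimately show ?thesis by blast
  qed
  let ?\<A> = "pullback_charts ?X fst {(- range z, \<lambda>x. x)}"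
  have A: "(U, \<phi>) \<in> ?\<A> \<longleftrightarrow> \<phi> = fst \<and> openin (top_of_set ?X) U \<and>
        openin (top_of_set (- range z)) (fst ` U) \<and> (\<exists>g. homeomorphism U (fst ` U) fst g)" for U \<phi>
    by (auto simp: pullback_charts_def comp_def fun_eq_iff)
  have cover: "\<exists>U. p \<in> U \<and> (U, fst) \<in> ?\<A>" if p: "p \<in> ?X" for p
  proof -
    obtain x0 w0 where p0: "p = (x0, w0)" by force
    with p have x0: "w0 ^ n = f x0" "x0 \<notin> range z" unfolding X by auto
    then have "f x0 \<noteq> 0" using f0 by auto
    with x0 n have w0: "w0 \<in> - {0}" by (auto simp: power_0_left)
    have "covering_space (- {0}) (\<lambda>z::complex. z^n) (- {0})"
      using n by (intro covering_space_power_punctured_plane) auto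
    from covering_space_local_homeomorphism[OF this w0]
    obtain T u q where T: "w0 \<in> T" "openin (top_of_set (- {0})) T"
      "w0 ^ n \<in> u" "openin (top_of_set (- {0})) u" "homeomorphism T u (\<lambda>z. z ^ n) q" by metis
    have oT: "open T" and ou: "open u"
      using T open_openin_trans by (metis open_Compl closed_singleton openin_open_eq)+
    let ?U = "?X \<inter> UNIV \<times> T"
    define B where "B = f -` u \<inter> - range z"
    have "open B" unfolding B_def
      by (intro open_Int opn) (use contf ou in \<open>auto simp: open_vimage\<close>)
    have qh: "\<And>y. y \<in> u \<Longrightarrow> q y \<in> T \<and> q y ^ n = y" "\<And>w. w \<in> T \<Longrightarrow> q (w ^ n) = w \<and> w ^ n \<in> u"
      "continuous_on u q"
      using T(5) by (auto simp: homeomorphism_def)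
    have im: "fst ` ?U = B"
    proof
      show "fst ` ?U \<subseteq> B" using qh(2) unfolding X B_def by auto metis
      show "B \<subseteq> fst ` ?U"
      proof
        fix x assume x: "x \<in> B"
        then have "(x, q (f x)) \<in> ?U" using qh(1) unfolding X B_def by auto
        then show "x \<in> fst ` ?U" by force
      qed
    qed
    have "homeomorphism ?U B fst (\<lambda>x. (x, q (f x)))"
    proof (rule homeomorphismI)
      show "continuous_on B (\<lambda>x. (x, q (f x)))"
        by (intro continuous_intros continuous_on_compose2[OF qh(3)]
            continuous_on_subset[OF contf]) (auto simp: B_def)
      show "(\<lambda>x. (x, q (f x))) ` B \<subseteq> ?U"
        using qh(1) unfolding X B_def by auto
      show "(fst y, q (f (fst y))) = y" if "y \<in> ?U" for y
        proof -
        have y: "snd y \<in> T" "snd y ^ n = f (fst y)" using that unfolding X by auto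
        from qh(2)[OF y(1)] have "q (f (fst y)) = snd y" unfolding y(2) by (rule conjunct1)
        then show ?thesis by (simp add: prod_eq_iff)
      qed
      show "continuous_on ?U fst" by (intro continuous_intros)
      show "fst ` ?U \<subseteq> B" using im by (rule equalityD1)
    qed simp
    moreover have "openin (top_of_set ?X) ?U"
      by (intro openin_open_Int open_Times) (auto simp: oT)
    moreover have "openin (top_of_set (- range z)) B"
      using \<open>open B\<close> by (simp add: B_def openin_open_eq opn)
    ultimately have "(?U, fst) \<in> ?\<A>" unfolding A im by (intro conjI refl exI)
    moreover have "p \<in> ?U" using p T(1) unfolding p0 by (intro IntI SigmaI UNIV_I)
    ultimately show ?thesis by (intro exI[of _ ?U] conjI)
  qed
  have "(\<Union>(U, \<phi>)\<in>?\<A>. U) = ?X"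
  proof
    show "(\<Union>(U, \<phi>)\<in>?\<A>. U) \<subseteq> ?X"
    proof (rule UN_least)
      fix c assume c: "c \<in> ?\<A>"
      obtain U \<phi> where U: "c = (U, \<phi>)" by (cases c)
      with c have "openin (top_of_set ?X) U" unfolding U A by (elim conjE)
      then show "(case c of (U, \<phi>) \<Rightarrow> U) \<subseteq> ?X" unfolding U prod.case by (rule openin_imp_subset)
    qed
    show "?X \<subseteq> (\<Union>(U, \<phi>)\<in>?\<A>. U)"
    proof
      fix p assume "p \<in> ?X"
      from cover[OF this] obtain U where "p \<in> U" "(U, fst) \<in> ?\<A>" by (elim exE conjE)
      then show "p \<in> (\<Union>(U, \<phi>)\<in>?\<A>. U)" by (intro UN_I[of "(U, fst)"]) (simp_all only: prod.case)
    qed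
  qed
  moreover have "\<forall>(U, \<phi>)\<in>?\<A>. openin (top_of_set ?X) U \<and>
        open (\<phi> ` U) \<and> (\<exists>g. homeomorphism U (\<phi> ` U) \<phi> g)"
  proof (intro ballI, clarify)
    fix U \<phi> assume "(U, \<phi>) \<in> ?\<A>"
    then have U: "\<phi> = fst" "openin (top_of_set ?X) U"
      "openin (top_of_set (- range z)) (fst ` U)" "\<exists>g. homeomorphism U (fst ` U) fst g"
      unfolding A by simp_all
    have "open (fst ` U)" using U(3) opn by (simp only: openin_open_eq)
    with U show "openin (top_of_set ?X) U \<and> open (\<phi> ` U) \<and>
        (\<exists>g. homeomorphism U (\<phi> ` U) \<phi> g)" by blast
  qed
  moreover have "\<forall>(U, \<phi>)\<in>?\<A>. \<forall>(V, \<psi>)\<in>?\<A>. \<forall>p\<in>U \<inter> V.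
        \<exists>t W. openin (top_of_set U) W \<and> p \<in> W \<and> W \<subseteq> V \<and> (\<forall>q\<in>W. \<psi> q = \<phi> q + t)"
  proof clarify
    fix U \<phi> V \<psi> and p :: "complex \<times> complex"
    assume UV: "(U, \<phi>) \<in> ?\<A>" "(V, \<psi>) \<in> ?\<A>" and p: "p \<in> U" "p \<in> V"
    have U: "\<phi> = fst" "openin (top_of_set ?X) U" using UV(1) unfolding A by simp_all
    have V: "\<psi> = fst" "openin (top_of_set ?X) V" using UV(2) unfolding A by simp_all
    have "openin (top_of_set U) (U \<inter> V)"
      using openin_Int[OF U(2) V(2)] openin_imp_subset[OF U(2)]
      by (intro openin_subset_trans[of ?X "U \<inter> V" U]) (rule inf_le1 | assumption)+
    then show "\<exists>t W. openin (top_of_set U) W \<and> p \<in> W \<and> W \<subseteq> V \<and> (\<forall>q\<in>W. \<psi> q = \<phi> q + t)"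
      using p unfolding U(1) V(1) by (intro exI[of _ 0] exI[of _ "U \<inter> V"]) simp
  qed
  ultimately show ?thesis
    using sub op disc
    by (simp add: translation_surface_def superelliptic_curve_def punctured_plane_def
        regular_points_def)
qed

end

theory Submission
  imports Defs
begin

text \<open>
  On the connected set \<open>- range z\<close> an affine diffeomorphism is the restriction of an affine map
  \<open>L x = A x + t\<close> permuting the zeros of \<open>f\<close>. It lifts to the curve as \<open>(x, w) \<mapsto> (L x, w g(x))\<close> once
  \<open>f \<circ> L / f\<close> has a continuous \<open>n\<close>-th root \<open>g\<close> off the zeros. Write \<open>A u = \<alpha> u + \<beta> cnj u\<close>; then
  \<open>|\<beta>| < |\<alpha>|\<close> because \<open>det A > 0\<close>. The function
  \<open>F = \<alpha> f + \<beta> cnj f \<cdot> f'\<^sup>2 / (|f'|\<^sup>2 + |f|\<^sup>2)\<close> behaves like \<open>f'(c) A(x - c)\<close> near a zero \<open>c\<close>, and \<open>F / f\<close>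
  stays in the disc of radius \<open>|\<beta>|\<close> about \<open>\<alpha>\<close>, so it has a continuous logarithm; \<open>f \<circ> L / F\<close> extends
  to a continuous function without zeros on the whole plane, so it has one too. The product of the
  two quotients is \<open>f \<circ> L / f\<close>.
\<close>

section \<open>Differentials\<close>

lemma matrix_act_linear: "linear (matrix_act A)"
  by (rule linearI) (auto simp: matrix_act_def complex_eq_iff algebra_simps)

lemma matrix_act_add: "matrix_act A (x + y) = matrix_act A x + matrix_act A y"
  by (rule linear_add[OF matrix_act_linear])

lemma matrix_act_diff: "matrix_act A (x - y) = matrix_act A x - matrix_act A y"
  by (rule linear_diff[OF matrix_act_linear])

lemma continuous_on_matrix_act [continuous_intros]:
  "continuous_on S h \<Longrightarrow> continuous_on S (\<lambda>x. matrix_act A (h x))"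
  unfolding matrix_act_def by (intro continuous_intros)

lemma matrix_act_mult: "matrix_act (A ** B) x = matrix_act A (matrix_act B x)"
  by (simp add: matrix_act_def matrix_matrix_mult_def sum_2 algebra_simps)

lemma matrix_act_one: "matrix_act (mat 1) x = x"
  by (simp add: matrix_act_def mat_def)

text \<open>Differences of nearby points cancel the translation parts, so the two linear parts agree
  on short vectors; one short vector along each axis recovers the two columns.\<close>

lemma matrix_act_eqI:
  assumes "open X" "X \<noteq> {}" and eq: "\<And>x. x \<in> X \<Longrightarrow> matrix_act A x + s = matrix_act B x + t"
  shows "A = B"
proof -
  obtain x0 where x0: "x0 \<in> X" using assms(2) by blast
  then obtain e where e: "e > 0" "ball x0 e \<subseteq> X" using assms(1) open_contains_ball by blast
  define d where "d = e / 2"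
  have d: "d > 0" using e by (simp add: d_def)
  have *: "matrix_act A v = matrix_act B v" if "norm v = d" for v
  proof -
    have "x0 + v \<in> ball x0 e" using that e by (simp add: dist_norm d_def)
    with e have 1: "matrix_act A (x0 + v) + s = matrix_act B (x0 + v) + t" by (intro eq) auto
    have "matrix_act A v = (matrix_act A (x0 + v) + s) - (matrix_act A x0 + s)"
      by (simp add: matrix_act_add)
    also have "\<dots> = matrix_act B v"
      unfolding 1 eq[OF x0] by (simp add: matrix_act_add)
    finally show ?thesis .
  qed
  from *[of "Complex d 0"] *[of "Complex 0 d"] d show ?thesis
    by (simp add: matrix_act_def vec_eq_iff forall_2 cmod_def)
qed

section \<open>Differentials in charts\<close>

lemma has_differential_atD:
  assumes "has_differential_at S T p A" "(U, \<phi>) \<in> charts S" "(V, \<psi>) \<in> charts S" "p \<in> U" "T p \<in> V"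
  obtains t W where "openin (top_of_set U) W" "p \<in> W" "T ` W \<subseteq> V"
    "\<And>q. q \<in> W \<Longrightarrow> \<psi> (T q) = matrix_act A (\<phi> q) + t"
proof -
  have "\<exists>t W. openin (top_of_set U) W \<and> p \<in> W \<and> T ` W \<subseteq> V \<and>
      (\<forall>q\<in>W. \<psi> (T q) = matrix_act A (\<phi> q) + t)"
    using bspec[OF bspec[OF assms(1)[unfolded has_differential_at_def] assms(2), unfolded prod.case]
        assms(3)] assms(4,5) by simp
  then show ?thesis using that by (elim exE conjE) blast
qed

lemma has_differential_atI:
  assumes "\<And>U \<phi> V \<psi>. (U, \<phi>) \<in> charts S \<Longrightarrow> (V, \<psi>) \<in> charts S \<Longrightarrow> p \<in> U \<Longrightarrow> T p \<in> V \<Longrightarrow>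
    \<exists>t W. openin (top_of_set U) W \<and> p \<in> W \<and> T ` W \<subseteq> V \<and>
           (\<forall>q\<in>W. \<psi> (T q) = matrix_act A (\<phi> q) + t)"
  shows "has_differential_at S T p A"
  unfolding has_differential_at_def by (intro ballI, clarify) (rule assms)

context
  fixes S :: "('a::topological_space, 'm) translation_data_scheme"
  assumes S: "translation_surface S"
begin

lemma chart_at:
  assumes "p \<in> regular_points S"
  obtains U \<phi> where "(U, \<phi>) \<in> charts S" "p \<in> U"
proof -
  have "(\<Union>(U, \<phi>)\<in>charts S. U) = regular_points S"
    using S unfolding translation_surface_def by (elim conjE)
  with assms have "p \<in> (\<Union>(U, \<phi>)\<in>charts S. U)" by simp
  then show ?thesis using that by (elim UN_E) (auto split: prod.splits)
qed

lemma chart_open: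
  assumes "(U, \<phi>) \<in> charts S"
  shows "openin (top_of_set (points S)) U" "U \<subseteq> points S" "U \<subseteq> regular_points S" "open (\<phi> ` U)"
    "\<exists>g. homeomorphism U (\<phi> ` U) \<phi> g"
proof -
  have "\<forall>(U, \<phi>)\<in>charts S. openin (top_of_set (regular_points S)) U \<and>
        open (\<phi> ` U) \<and> (\<exists>g. homeomorphism U (\<phi> ` U) \<phi> g)"
    using S unfolding translation_surface_def by (elim conjE)
  from bspec[OF this assms] have *: "openin (top_of_set (regular_points S)) U" "open (\<phi> ` U)"
      "\<exists>g. homeomorphism U (\<phi> ` U) \<phi> g"
    by simp_all
  have reg: "openin (top_of_set (points S)) (regular_points S)"
    using S unfolding translation_surface_def by (elim conjE)
  show "openin (top_of_set (points S)) U" using *(1) reg by (rule openin_trans)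
  then show "U \<subseteq> points S" by (rule openin_imp_subset)
  show "U \<subseteq> regular_points S" using *(1) by (rule openin_imp_subset)
  show "open (\<phi> ` U)" "\<exists>g. homeomorphism U (\<phi> ` U) \<phi> g" by fact+
qed

text \<open>Both affine formulas for \<open>T\<close> hold on a common neighbourhood of
  \<open>p\<close>. Its image under a chart is open in the plane, and there the linear part can be
  read off.\<close>

lemma has_differential_at_unique:
  assumes p: "p \<in> regular_points S" "T p \<in> regular_points S"
    and A: "has_differential_at S T p A" and B: "has_differential_at S T p B"
  shows "A = B"
proof -
  obtain U \<phi> where U: "(U, \<phi>) \<in> charts S" "p \<in> U" using chart_at[OF p(1)] .
  obtain V \<psi> where V: "(V, \<psi>) \<in> charts S" "T p \<in> V" using chart_at[OF p(2)] .
  obtain s W1 where W1: "openin (top_of_set U) W1" "p \<in> W1" "T ` W1 \<subseteq> V"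
    "\<And>q. q \<in> W1 \<Longrightarrow> \<psi> (T q) = matrix_act A (\<phi> q) + s"
    by (rule has_differential_atD[OF A U(1) V(1) U(2) V(2)]) (rule that)
  obtain t W2 where W2: "openin (top_of_set U) W2" "p \<in> W2" "T ` W2 \<subseteq> V"
    "\<And>q. q \<in> W2 \<Longrightarrow> \<psi> (T q) = matrix_act B (\<phi> q) + t"
    by (rule has_differential_atD[OF B U(1) V(1) U(2) V(2)]) (rule that)
  obtain g where g: "homeomorphism U (\<phi> ` U) \<phi> g" using chart_open[OF U(1)] by blast
  have "openin (top_of_set (\<phi> ` U)) (\<phi> ` (W1 \<inter> W2))"
    using homeomorphism_imp_open_map[OF g] W1 W2 by blast
  then have "open (\<phi> ` (W1 \<inter> W2))"
    using openin_open_trans chart_open(4)[OF U(1)] by blast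
  moreover have "\<phi> ` (W1 \<inter> W2) \<noteq> {}" using W1 W2 by blast
  moreover have "matrix_act A x + s = matrix_act B x + t" if "x \<in> \<phi> ` (W1 \<inter> W2)" for x
    using that W1(4) W2(4) by (metis IntD1 IntD2 imageE)
  ultimately show ?thesis by (rule matrix_act_eqI)
qed

text \<open>Read in charts, the identity is a transition map, hence a translation.\<close>

lemma has_differential_at_id: "has_differential_at S id p (mat 1)"
proof (rule has_differential_atI)
  fix U \<phi> V \<psi> assume *: "(U, \<phi>) \<in> charts S" "(V, \<psi>) \<in> charts S" "p \<in> U" "id p \<in> V"
  have "\<forall>(U, \<phi>)\<in>charts S. \<forall>(V, \<psi>)\<in>charts S. \<forall>p\<in>U \<inter> V.
      \<exists>t W. openin (top_of_set U) W \<and> p \<in> W \<and> W \<subseteq> V \<and> (\<forall>q\<in>W. \<psi> q = \<phi> q + t)"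
    using S unfolding translation_surface_def by (elim conjE)
  from bspec[OF this *(1)] *(2,3,4)
  have "\<exists>t W. openin (top_of_set U) W \<and> p \<in> W \<and> W \<subseteq> V \<and> (\<forall>q\<in>W. \<psi> q = \<phi> q + t)"
    by auto
  then show "\<exists>t W. openin (top_of_set U) W \<and> p \<in> W \<and> id ` W \<subseteq> V \<and>
      (\<forall>q\<in>W. \<psi> (id q) = matrix_act (mat 1) (\<phi> q) + t)"
    by (simp add: matrix_act_one)
qed

text \<open>A chart around the regular point \<open>T p\<close> mediates between the two affine
  formulas; continuity of \<open>T\<close> makes the preimage of the second neighbourhood
  open.\<close>

lemma has_differential_at_compose:
  assumes cont: "continuous_on (points S) T" and Tp: "T p \<in> regular_points S"
    and A: "has_differential_at S T p A" and B: "has_differential_at S T' (T p) B"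
  shows "has_differential_at S (T' \<circ> T) p (B ** A)"
proof (rule has_differential_atI)
  fix U \<phi> V \<psi> assume U: "(U, \<phi>) \<in> charts S" and V: "(V, \<psi>) \<in> charts S"
    and p: "p \<in> U" "(T' \<circ> T) p \<in> V"
  obtain M \<mu> where M: "(M, \<mu>) \<in> charts S" "T p \<in> M" using chart_at[OF Tp] .
  obtain s W1 where W1: "openin (top_of_set U) W1" "p \<in> W1" "T ` W1 \<subseteq> M"
    "\<And>q. q \<in> W1 \<Longrightarrow> \<mu> (T q) = matrix_act A (\<phi> q) + s"
    by (rule has_differential_atD[OF A U(1) M(1) p(1) M(2)]) (rule that)
  obtain t W2 where W2: "openin (top_of_set M) W2" "T p \<in> W2" "T' ` W2 \<subseteq> V"
    "\<And>q. q \<in> W2 \<Longrightarrow> \<psi> (T' q) = matrix_act B (\<mu> q) + t"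
    by (rule has_differential_atD[OF B M(1) V(1) M(2) p(2)[unfolded comp_apply]]) (rule that)
  have "W1 \<subseteq> points S" using W1(1) chart_open(2)[OF U] openin_imp_subset by blast
  then have "openin (top_of_set W1) (W1 \<inter> T -` W2)"
    using continuous_openin_preimage[of W1 T M W2] continuous_on_subset[OF cont] W1(3) W2(1)
    by (auto simp: Pi_iff)
  then have "openin (top_of_set U) (W1 \<inter> T -` W2)" using W1(1) openin_trans by blast
  moreover have "p \<in> W1 \<inter> T -` W2" "(T' \<circ> T) ` (W1 \<inter> T -` W2) \<subseteq> V" using W1(2) W2(2,3) by auto
  moreover have "\<forall>q\<in>W1 \<inter> T -` W2. \<psi> ((T' \<circ> T) q) = matrix_act (B ** A) (\<phi> q) + (matrix_act B s + t)"
    by (simp add: W1(4) W2(4) matrix_act_mult matrix_act_add)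
  ultimately show "\<exists>t W. openin (top_of_set U) W \<and> p \<in> W \<and> (T' \<circ> T) ` W \<subseteq> V \<and>
      (\<forall>q\<in>W. \<psi> ((T' \<circ> T) q) = matrix_act (B ** A) (\<phi> q) + t)"
    by (intro exI conjI)
qed

text \<open>The affine formula of \<open>T\<close> is solved for the source point. The neighbourhood
  used for \<open>g\<close> is the image of \<open>W\<close> under \<open>T\<close>, open because
  \<open>T\<close> is a homeomorphism.\<close>

lemma has_differential_at_inverse:
  assumes hom: "homeomorphism (points S) (points S) T g" and q: "q \<in> points S"
    and A: "has_differential_at S T q A" and B: "B ** A = mat 1"
  shows "has_differential_at S g (T q) B"
proof (rule has_differential_atI)
  have gT: "\<And>r. r \<in> points S \<Longrightarrow> g (T r) = r" using hom by (simp add: homeomorphism_def)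
  fix U \<phi> V \<psi> assume U: "(U, \<phi>) \<in> charts S" and V: "(V, \<psi>) \<in> charts S"
    and p: "T q \<in> U" "g (T q) \<in> V"
  then have "q \<in> V" using gT q by simp
  obtain t W where W: "openin (top_of_set V) W" "q \<in> W" "T ` W \<subseteq> U"
    "\<And>r. r \<in> W \<Longrightarrow> \<phi> (T r) = matrix_act A (\<psi> r) + t"
    by (rule has_differential_atD[OF A V(1) U(1) \<open>q \<in> V\<close> p(1)]) (rule that)
  have sub: "W \<subseteq> V" "W \<subseteq> points S"
    using W(1) chart_open(2)[OF V] openin_imp_subset by blast+
  have "openin (top_of_set (points S)) (T ` W)"
    using homeomorphism_imp_open_map[OF hom] openin_trans[OF W(1) chart_open(1)[OF V]] by blast
  then have "openin (top_of_set U) (T ` W)"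
    using openin_subset_trans W(3) chart_open(2)[OF U] by blast
  moreover have "\<forall>s\<in>T ` W. \<psi> (g s) = matrix_act B (\<phi> s) + (- matrix_act B t)"
  proof
    fix s assume s: "s \<in> T ` W"
    obtain r where r: "r \<in> W" "s = T r" using s by blast
    then have "g s = r" using gT sub by blast
    then show "\<psi> (g s) = matrix_act B (\<phi> s) + (- matrix_act B t)"
      by (simp add: r W(4)[OF r(1)] matrix_act_add B matrix_act_one flip: matrix_act_mult)
  qed
  moreover have "g ` T ` W \<subseteq> V"
  proof
    fix y assume "y \<in> g ` T ` W"
    then obtain r where "r \<in> W" "y = g (T r)" by blast
    moreover from this have "g (T r) = r" using gT sub by blast
    ultimately show "y \<in> V" using sub by auto
  qed
  moreover have "T q \<in> T ` W" using W(2) by (rule imageI)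
  ultimately show "\<exists>t W. openin (top_of_set U) W \<and> T q \<in> W \<and> g ` W \<subseteq> V \<and>
      (\<forall>q\<in>W. \<psi> (g q) = matrix_act B (\<phi> q) + t)"
    by (intro exI conjI)
qed

section \<open>Membership in the affine group\<close>

lemma affine_diffeo_regular_points:
  assumes hom: "homeomorphism (points S) (points S) T g" and c: "T ` cone_points S = cone_points S"
  shows "T ` regular_points S = regular_points S" "g ` cone_points S = cone_points S"
proof -
  have sub: "cone_points S \<subseteq> points S" using S by (simp add: translation_surface_def)
  have inj: "inj_on T (points S)" and im: "T ` points S = points S"
    and gT: "\<And>x. x \<in> points S \<Longrightarrow> g (T x) = x"
    using hom by (auto simp: homeomorphism_def intro: inj_on_inverseI)
  show "T ` regular_points S = regular_points S"
    unfolding regular_points_def using inj_on_image_set_diff[OF inj _ sub, of "points S"] im c by simp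
  have "g ` T ` cone_points S = cone_points S"
    using gT sub by (force simp: image_image)
  then show "g ` cone_points S = cone_points S" by (simp add: c)
qed

text \<open>\<open>orientation_preserving\<close> speaks of every differential at a point;
  uniqueness reduces this to the one matrix \<open>A\<close>, whose determinant also gives
  invertibility.\<close>

lemma Aff_plusI:
  assumes hom: "homeomorphism (points S) (points S) T g" and c: "T ` cone_points S = cone_points S"
    and A: "has_differential S T A" and det: "det A > 0"
  shows "T \<in> Aff_plus S"
proof -
  have reg: "T p \<in> regular_points S" if "p \<in> regular_points S" for p
    using affine_diffeo_regular_points(1)[OF hom c] that by blast
  have "A = B" if p: "p \<in> regular_points S" and B: "has_differential_at S T p B" for p B
    by (rule has_differential_at_unique[OF p reg[OF p] _ B])
      (use A p in \<open>simp add: has_differential_def\<close>)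
  then have "orientation_preserving S T"
    using det unfolding orientation_preserving_def by blast
  moreover have "invertible A" using det invertible_det_nz[of A] by simp
  then have "affine_diffeo S T"
    using hom c A unfolding affine_diffeo_def has_differential_def by blast
  ultimately show ?thesis by (simp add: Aff_plus_def)
qed

lemma Aff_plusE:
  assumes "T \<in> Aff_plus S"
  obtains g where "homeomorphism (points S) (points S) T g" "T ` cone_points S = cone_points S"
    "T ` regular_points S = regular_points S"
  using assms affine_diffeo_regular_points unfolding Aff_plus_def affine_diffeo_def by blast

end

section \<open>Veech groups\<close>

lemma det_pos_inverse:
  fixes A :: "real^2^2"
  assumes "det A > 0"
  obtains B where "A ** B = mat 1" "B ** A = mat 1" "det B > 0"
proof -
  obtain B where B: "A ** B = mat 1" "B ** A = mat 1"
    using assms invertible_det_nz[of A] unfolding invertible_def by auto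
  then have "det A * det B = 1" by (metis det_I det_mul)
  with assms have "det B > 0" by (metis zero_less_mult_pos zero_less_one)
  with B that show ?thesis by blast
qed

lemma group_GL2_plus: "group GL2_plus"
proof (rule groupI)
  fix A assume "A \<in> carrier GL2_plus"
  then show "\<exists>B\<in>carrier GL2_plus. B \<otimes>\<^bsub>GL2_plus\<^esub> A = \<one>\<^bsub>GL2_plus\<^esub>"
    using det_pos_inverse[of A] by (auto simp: GL2_plus_def)
qed (auto simp: GL2_plus_def det_mul matrix_mul_assoc)

lemma veech_group_eq: "veech_group S = GL2_plus\<lparr>carrier := carrier (veech_group S)\<rparr>"
  by (simp add: veech_group_def)

lemma carrier_veech_group:
  "carrier (veech_group S) = {A. \<exists>T\<in>Aff_plus S. has_differential S T A}"
  by (simp add: veech_group_def)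

text \<open>
  Without regular points every matrix would be a differential of the identity.
\<close>
lemma subgroup_veech_group:
  fixes S :: "('a::topological_space, 'm) translation_data_scheme"
  assumes S: "translation_surface S" and ne: "regular_points S \<noteq> {}"
  shows "subgroup (carrier (veech_group S)) GL2_plus"
proof (rule group.subgroupI[OF group_GL2_plus])
  \<comment> \<open>Orientation preservation bounds a determinant only at a regular point, and
    \<open>ne\<close> provides one.\<close>
  have det: "det A > 0" if "T \<in> Aff_plus S" "has_differential S T A" for T A
    using that ne unfolding Aff_plus_def orientation_preserving_def has_differential_def by blast
  show "carrier (veech_group S) \<subseteq> carrier GL2_plus"
    using det by (auto simp: carrier_veech_group GL2_plus_def)
  have "id \<in> Aff_plus S"
    using has_differential_at_id[OF S] homeomorphism_ident[of "points S"]
    by (intro Aff_plusI[OF S, of id id "mat 1"]) (auto simp: has_differential_def id_def)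
  then show "carrier (veech_group S) \<noteq> {}"
    using has_differential_at_id[OF S] by (auto simp: carrier_veech_group has_differential_def)
next
  fix A assume "A \<in> carrier (veech_group S)"
  then obtain T where T: "T \<in> Aff_plus S" "has_differential S T A"
    by (auto simp: carrier_veech_group)
  then have "det A > 0"
    using ne unfolding Aff_plus_def orientation_preserving_def has_differential_def by blast
  then obtain B where B: "A ** B = mat 1" "B ** A = mat 1" "det B > 0" by (rule det_pos_inverse)
  obtain g where g: "homeomorphism (points S) (points S) T g" "T ` cone_points S = cone_points S"
    "T ` regular_points S = regular_points S" using Aff_plusE[OF S T(1)] .
  have hd: "has_differential S g B"
    unfolding has_differential_def
  proof
    fix p assume "p \<in> regular_points S"
    then obtain q where q: "q \<in> regular_points S" "p = T q" using g(3) by blast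
    with T(2) show "has_differential_at S g p B"
      unfolding has_differential_def q(2)
      by (intro has_differential_at_inverse[OF S g(1) _ _ B(2)]) (auto simp: regular_points_def)
  qed
  have "g \<in> Aff_plus S"
    by (rule Aff_plusI[OF S homeomorphism_symD[OF g(1)]
          affine_diffeo_regular_points(2)[OF S g(1,2)] hd B(3)])
  moreover have "inv\<^bsub>GL2_plus\<^esub> A = B"
    by (rule group.inv_equality[OF group_GL2_plus])
      (use B \<open>det A > 0\<close> in \<open>auto simp: GL2_plus_def\<close>)
  ultimately show "inv\<^bsub>GL2_plus\<^esub> A \<in> carrier (veech_group S)"
    using hd by (auto simp: carrier_veech_group)
next
  fix A B assume "A \<in> carrier (veech_group S)" "B \<in> carrier (veech_group S)"
  then obtain T T' where T: "T \<in> Aff_plus S" "has_differential S T A"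
    and T': "T' \<in> Aff_plus S" "has_differential S T' B"
    by (auto simp: carrier_veech_group)
  then have "det (A ** B) > 0"
    using ne unfolding Aff_plus_def orientation_preserving_def has_differential_def det_mul
    by (blast intro: mult_pos_pos)
  obtain g where g: "homeomorphism (points S) (points S) T g" "T ` cone_points S = cone_points S"
    "T ` regular_points S = regular_points S" using Aff_plusE[OF S T(1)] .
  obtain g' where g': "homeomorphism (points S) (points S) T' g'"
    "T' ` cone_points S = cone_points S"
    "T' ` regular_points S = regular_points S" using Aff_plusE[OF S T'(1)] .
  have hd: "has_differential S (T \<circ> T') (A ** B)"
    unfolding has_differential_def
  proof
    fix p assume "p \<in> regular_points S"
    with g' T T' show "has_differential_at S (T \<circ> T') p (A ** B)"
      unfolding has_differential_def
      by (intro has_differential_at_compose[OF S]) (auto simp: homeomorphism_def)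
  qed
  have "T \<circ> T' \<in> Aff_plus S"
    by (rule Aff_plusI[OF S homeomorphism_compose[OF g'(1) g(1)] _ hd \<open>det (A ** B) > 0\<close>])
      (simp add: g(2) g'(2) flip: image_image)
  with hd show "A \<otimes>\<^bsub>GL2_plus\<^esub> B \<in> carrier (veech_group S)"
    by (auto simp: carrier_veech_group GL2_plus_def)
qed

section \<open>Zeros of Weierstrass maps\<close>

lemma weierstrass_term_holomorphic: "weierstrass_term d a holomorphic_on A"
  unfolding weierstrass_term_def[abs_def] by (cases "a = 0") (auto intro!: holomorphic_intros)

lemma weierstrass_term_eq_0_iff: "weierstrass_term d a x = 0 \<longleftrightarrow> a \<noteq> 0 \<and> x = a"
  by (auto simp: weierstrass_term_def field_simps)

text \<open>In the product rule at \<open>a\<close> the factor \<open>1 - x / a\<close> vanishes,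
  which leaves \<open>- e a / a\<close> with \<open>e\<close> the exponential factor.\<close>

lemma deriv_weierstrass_term_nonzero:
  assumes "a \<noteq> 0"
  shows "deriv (weierstrass_term d a) a \<noteq> 0"
proof -
  define e where "e = (\<lambda>x. exp (\<Sum>k=1..d. (x / a) ^ k / of_nat k))"
  have "e holomorphic_on UNIV" unfolding e_def using assms by (auto intro!: holomorphic_intros)
  then have "(e has_field_derivative deriv e a) (at a)"
    by (intro holomorphic_derivI[of e UNIV]) auto
  then have "((\<lambda>x. (1 - x / a) * e x) has_field_derivative - e a / a) (at a)"
    using assms by (auto intro!: derivative_eq_intros)
  moreover have "weierstrass_term d a = (\<lambda>x. (1 - x / a) * e x)"
    using assms by (auto simp: weierstrass_term_def weierstrass_factor_def e_def)
  ultimately have "deriv (weierstrass_term d a) a = - e a / a" by (metis DERIV_imp_deriv)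
  moreover have "e a \<noteq> 0" by (simp add: e_def)
  ultimately show ?thesis using assms by simp
qed

text \<open>
  The derivatives of the partial products at a zero converge to the derivative of the product,
  and each of them is the derivative of the vanishing factor times the other factors.
\<close>
lemma weierstrass_map_simple_zero:
  assumes inj: "inj z" and f: "weierstrass_map z f"
  shows "deriv f (z k) \<noteq> 0"
proof -
  from f obtain h d where h: "h holomorphic_on UNIV" "\<And>x. h x \<noteq> 0"
    and c: "\<And>x. convergent_prod (\<lambda>k. weierstrass_term (d k) (z k) x)"
    and u: "\<And>K. compact K \<Longrightarrow> uniform_limit K (\<lambda>N x. \<Prod>k<N. weierstrass_term (d k) (z k) x)
             (\<lambda>x. \<Prod>k. weierstrass_term (d k) (z k) x) sequentially"
    and feq: "\<And>x. f x = h x * x ^ (if 0 \<in> range z then 1 else 0)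
                   * (\<Prod>k. weierstrass_term (d k) (z k) x)"
    unfolding weierstrass_map_def by blast
  define w where "w k = weierstrass_term (d k) (z k)" for k
  define P where "P = (\<lambda>x. \<Prod>k. w k x)"
  then have P_app: "P x = (\<Prod>k. w k x)" for x by simp
  note w = weierstrass_term_holomorphic[of "d k" "z k" for k, folded w_def]
  have w0: "w j x = 0 \<longleftrightarrow> z j \<noteq> 0 \<and> x = z j" for j x
    by (simp add: w_def weierstrass_term_eq_0_iff)
  note c = c[folded w_def] and u = u[folded w_def, folded P_def] and feq = feq[folded w_def, folded P_app]
  have holP: "P holomorphic_on UNIV"
  proof (rule holomorphic_uniform_sequence[where f = "\<lambda>N x. \<Prod>k<N. w k x"])
    show "(\<lambda>x. \<Prod>k<N. w k x) holomorphic_on UNIV" for N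
      by (intro holomorphic_intros w)
    show "\<exists>d>0. cball x d \<subseteq> UNIV \<and> uniform_limit (cball x d) (\<lambda>N x. \<Prod>k<N. w k x) P sequentially"
      for x using u[OF compact_cball[of x 1]] by (intro exI[of _ 1]) simp
  qed simp
  then have P': "(P has_field_derivative deriv P x) (at x)" for x
    by (intro holomorphic_derivI[of P UNIV]) auto
  have h': "(h has_field_derivative deriv h x) (at x)" for x
    using h(1) by (intro holomorphic_derivI[of h UNIV]) auto
  have P0: "P x = 0 \<longleftrightarrow> (\<exists>j. w j x = 0)" for x
    unfolding P_app using has_prod_eq_0_iff[OF convergent_prod_has_prod[OF c[of x]]] by auto
  show ?thesis
  proof (cases "z k = 0")
    case True
    then have "0 \<in> range z" by (metis rangeI)
    \<comment> \<open>The zero at the origin comes from the monomial alone: the index with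
      \<open>z k = 0\<close> contributes the factor 1 to the product, so \<open>P 0\<close> is
      nonzero.\<close>
    then have "f = (\<lambda>x. h x * x * P x)" using feq by auto
    moreover have "((\<lambda>x. h x * x * P x) has_field_derivative h 0 * P 0) (at 0)"
      by (rule derivative_eq_intros h' P' refl)+ simp
    ultimately have "deriv f 0 = h 0 * P 0" by (simp add: DERIV_imp_deriv)
    moreover have "P 0 \<noteq> 0" unfolding P0 w0 by auto
    ultimately show ?thesis using h(2) True by simp
  next
    case False
    define a where "a = z k"
    have a: "a \<noteq> 0" using False by (simp add: a_def)
    \<comment> \<open>The factors at \<open>a\<close> with the vanishing one replaced by 1. Since
      the points are distinct, no other factor vanishes at \<open>a\<close>.\<close>
    define v where "v j = (if j = k then 1 else w j a)" for j
    have v0: "v j \<noteq> 0" for j using inj by (auto simp: v_def w0 a_def inj_def)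
    have wka: "w k a = 0" using a by (simp add: w0 a_def)
    obtain M p where M: "raw_has_prod (\<lambda>j. w j a) M p"
      using c[of a] unfolding convergent_prod_def by blast
    \<comment> \<open>The tail from \<open>M\<close> on contains no vanishing factor, so it starts
      beyond \<open>k\<close>, and replacing factor \<open>k\<close> by 1 does not change
      it.\<close>
    have "M > k" using raw_has_prod_imp_nonzero[OF M, of k] wka by linarith
    then have "raw_has_prod v M p" using M by (simp add: raw_has_prod_def v_def)
    then have cv: "convergent_prod v" unfolding convergent_prod_def by blast
    have lim: "(\<lambda>n. \<Prod>j\<le>n. v j) \<longlonglongrightarrow> prodinf v"
      by (rule convergent_prod_LIMSEQ[OF cv])
    have nz: "prodinf v \<noteq> 0"
      using has_prod_eq_0_iff[OF convergent_prod_has_prod[OF cv]] v0 by auto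
    have wk: "(w k has_field_derivative deriv (w k) a) (at a)"
      using w[of k UNIV] by (intro holomorphic_derivI[of _ UNIV]) auto
    have part: "deriv (\<lambda>x. \<Prod>j<Suc n. w j x) a = deriv (w k) a * (\<Prod>j\<le>n. v j)" if "n \<ge> k" for n
    proof -
      define R where "R x = (\<Prod>j\<in>{..n} - {k}. w j x)" for x
      have "R holomorphic_on UNIV" unfolding R_def by (intro holomorphic_intros w)
      then have R': "(R has_field_derivative deriv R a) (at a)"
        by (intro holomorphic_derivI[of R UNIV]) auto
      have "w k a = 0" using a by (simp add: w0 a_def)
      then have "((\<lambda>x. w k x * R x) has_field_derivative deriv (w k) a * R a) (at a)"
        by (auto intro!: derivative_eq_intros wk R')
      moreover have "(\<lambda>x. \<Prod>j<Suc n. w j x) = (\<lambda>x. w k x * R x)"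
        unfolding R_def lessThan_Suc_atMost using that by (auto simp: prod.remove[of _ k])
      moreover have "R a = (\<Prod>j\<le>n. v j)"
        unfolding R_def using that by (auto simp: prod.remove[of _ k] v_def intro!: prod.cong)
      ultimately show ?thesis by (simp add: DERIV_imp_deriv)
    qed
    have "uniform_limit (ball a 1) (\<lambda>N x. \<Prod>j<N. w j x) P sequentially"
      using uniform_limit_on_subset[OF u[OF compact_cball[of a 1]] ball_subset_cball] by simp
    then have "(\<lambda>N. deriv (\<lambda>x. \<Prod>j<N. w j x) a) \<longlonglongrightarrow> deriv P a"
      by (rule deriv_complex_uniform_limit) (auto intro!: always_eventually holomorphic_on_prod w)
    \<comment> \<open>The shift by one turns the factors below \<open>Suc n\<close> into those up to
      \<open>n\<close>, the form used in \<open>part\<close> and \<open>lim\<close>.\<close>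
    then have "(\<lambda>n. deriv (\<lambda>x. \<Prod>j<Suc n. w j x) a) \<longlonglongrightarrow> deriv P a"
      by (rule LIMSEQ_Suc)
    moreover have "(\<lambda>n. deriv (\<lambda>x. \<Prod>j<Suc n. w j x) a) \<longlonglongrightarrow> deriv (w k) a * prodinf v"
    proof (rule Lim_transform_eventually[OF tendsto_mult[OF tendsto_const lim]])
      show "\<forall>\<^sub>F n in sequentially. deriv (w k) a * (\<Prod>j\<le>n. v j) = deriv (\<lambda>x. \<Prod>j<Suc n. w j x) a"
        using eventually_ge_at_top[of k] by eventually_elim (rule part[symmetric])
    qed
    ultimately have "deriv P a = deriv (w k) a * prodinf v" by (rule LIMSEQ_unique)
    then have P'a: "deriv P a \<noteq> 0"
      using nz deriv_weierstrass_term_nonzero[OF a, of "d k"] by (simp add: w_def a_def)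
    have Pa: "P a = 0" unfolding P0 w0 using a a_def by blast
    define m :: nat where "m = (if 0 \<in> range z then 1 else 0)"
    have "f = (\<lambda>x. h x * x ^ m * P x)" using feq by (auto simp: m_def)
    \<comment> \<open>As \<open>P a = 0\<close>, only the term of the product rule that
      differentiates \<open>P\<close> survives.\<close>
    moreover have "((\<lambda>x. h x * x ^ m * P x) has_field_derivative h a * a ^ m * deriv P a) (at a)"
      by (rule derivative_eq_intros h' P' refl)+ (simp add: Pa)
    ultimately have "deriv f a = h a * a ^ m * deriv P a" by (simp add: DERIV_imp_deriv)
    then show ?thesis using P'a a h(2) by (simp add: a_def)
  qed
qed

section \<open>Roots of the quotient by an affine pullback\<close>

text \<open>\<alpha> and \<beta> are the Wirtinger derivatives of the real-linear map, and
  \<open>det A\<close> equals the difference of their squared norms.\<close>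

lemma matrix_act_complex:
  fixes A :: "real^2^2"
  assumes "det A > 0"
  obtains \<alpha> \<beta> where "\<And>u. matrix_act A u = \<alpha> * u + \<beta> * cnj u" "norm \<beta> < norm \<alpha>"
proof -
  define a b c d where abcd: "a = A $ 1 $ 1" "b = A $ 1 $ 2" "c = A $ 2 $ 1" "d = A $ 2 $ 2"
  define \<alpha> where "\<alpha> = Complex ((a + d) / 2) ((c - b) / 2)"
  define \<beta> where "\<beta> = Complex ((a - d) / 2) ((c + b) / 2)"
  have 1: "matrix_act A u = \<alpha> * u + \<beta> * cnj u" for u
    by (simp add: matrix_act_def \<alpha>_def \<beta>_def complex_eq_iff field_simps flip: abcd)
  have "a * d - b * c > 0" using assms by (simp add: det_2 abcd)
  moreover have "(norm \<alpha>)\<^sup>2 - (norm \<beta>)\<^sup>2 = a * d - b * c"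
    unfolding cmod_power2 \<alpha>_def \<beta>_def complex.sel by (simp add: power2_eq_square field_simps)
  ultimately have "(norm \<beta>)\<^sup>2 < (norm \<alpha>)\<^sup>2" by linarith
  then have "norm \<beta> < norm \<alpha>" using power2_less_imp_less norm_ge_zero by blast
  with 1 that show ?thesis by blast
qed

text \<open>Division by \<alpha> moves the value into the open unit disc about 1, which lies in the
  right half-plane; there the principal logarithm \<open>Ln\<close> is continuous.\<close>

lemma add_mult_div_not_nonpos:
  fixes \<alpha> \<beta> w :: complex
  assumes "norm \<beta> < norm \<alpha>" "norm w \<le> 1"
  shows "(\<alpha> + \<beta> * w) / \<alpha> \<notin> \<real>\<^sub>\<le>\<^sub>0"
proof -
  have a: "\<alpha> \<noteq> 0" using assms(1) by auto
  have "norm (\<beta> * w / \<alpha>) = norm \<beta> / norm \<alpha> * norm w" by (simp add: norm_mult norm_divide)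
  also have "\<dots> \<le> norm \<beta> / norm \<alpha> * 1" by (rule mult_left_mono) (use assms(2) in auto)
  also have "\<dots> < 1" using assms(1) a by (simp add: field_simps)
  finally have "Re (\<beta> * w / \<alpha>) > - 1" using abs_Re_le_cmod[of "\<beta> * w / \<alpha>"] by linarith
  moreover have "(\<alpha> + \<beta> * w) / \<alpha> = 1 + \<beta> * w / \<alpha>" using a by (simp add: field_simps)
  ultimately show ?thesis by (simp add: complex_nonpos_Reals_iff)
qed

text \<open>If \<beta> is nonzero, the quotient of \<open>f (L x)\<close> by \<open>f x\<close> has
  no limit at a zero \<open>c\<close>, because the quotient of \<open>A (x - c)\<close> by
  \<open>x - c\<close> depends on the direction. The auxiliary function \<open>F\<close> carries the
  same direction dependence, so that \<open>f (L x) / F x\<close> does have a limit.\<close>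

lemma affine_root_of_quotient:
  fixes f :: "complex \<Rightarrow> complex" and A :: "real^2^2"
  assumes hol: "f holomorphic_on UNIV" and simple: "\<And>x. f x = 0 \<Longrightarrow> deriv f x \<noteq> 0"
    and det: "det A > 0" and zeros: "\<And>x. f (matrix_act A x + t) = 0 \<longleftrightarrow> f x = 0" and n: "n > 0"
  obtains g where "continuous_on {x. f x \<noteq> 0} g"
    "\<And>x. f x \<noteq> 0 \<Longrightarrow> g x ^ n * f x = f (matrix_act A x + t)"
proof -
  obtain \<alpha> \<beta> where A: "\<And>u. matrix_act A u = \<alpha> * u + \<beta> * cnj u" and less: "norm \<beta> < norm \<alpha>"
    using matrix_act_complex[OF det] by blast
  have \<alpha>: "\<alpha> \<noteq> 0" using less by auto
  define L where "L x = matrix_act A x + t" for x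
  \<comment> \<open>At a zero of \<open>f\<close> this is
    \<open>deriv f x / cnj (deriv f x)\<close>, which turns the conjugate of
    \<open>deriv f x\<close> back into \<open>deriv f x\<close>. The summand with \<open>f x\<close>
    keeps the denominator positive at critical points.\<close>
  define r where "r x = (deriv f x)\<^sup>2 / of_real ((norm (deriv f x))\<^sup>2 + (norm (f x))\<^sup>2)" for x
  define w where "w x = cnj (f x) / f x * r x" for x
  define F where "F x = \<alpha> * f x + \<beta> * cnj (f x) * r x" for x
  define Z where "Z = {x. f x \<noteq> 0}"
  have contf: "continuous_on UNIV f" by (rule holomorphic_on_imp_continuous_on[OF hol])
  have "deriv f holomorphic_on UNIV" using hol by (intro holomorphic_intros) auto
  then have contf': "continuous_on UNIV (deriv f)" by (rule holomorphic_on_imp_continuous_on)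
  have contL: "continuous_on UNIV L" unfolding L_def by (intro continuous_intros)
  \<comment> \<open>Simplicity of the zeros means that \<open>f\<close> and its derivative never
    vanish together.\<close>
  have pos: "(norm (deriv f x))\<^sup>2 + (norm (f x))\<^sup>2 > 0" for x
    using simple[of x] by (cases "f x = 0") (auto intro: add_nonneg_pos)
  then have nz: "of_real ((norm (deriv f x))\<^sup>2 + (norm (f x))\<^sup>2) \<noteq> (0::complex)" for x
    by (metis less_irrefl of_real_eq_0_iff)
  have contr: "continuous_on UNIV r" unfolding r_def
    by (intro continuous_intros contf contf') (use nz in auto)
  have contF: "continuous_on UNIV F"
    unfolding F_def by (intro continuous_intros contf contr)
  have contw: "continuous_on Z w" unfolding w_def Z_def
    by (intro continuous_intros continuous_on_subset[OF contf] continuous_on_subset[OF contr]) auto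
  have openZ: "open Z" unfolding Z_def by (intro open_Collect_neq contf continuous_intros)
  have rle: "norm (r x) \<le> 1" for x
    using pos[of x] by (simp add: r_def norm_divide norm_power divide_simps del: of_real_add)
  have wle: "norm (w x) \<le> 1" if "f x \<noteq> 0" for x
    using that rle[of x] by (simp add: w_def norm_mult norm_divide)
  have Fw: "F x / f x = \<alpha> + \<beta> * w x" if "f x \<noteq> 0" for x
    using that by (simp add: F_def w_def field_simps)
  have F0: "F x \<noteq> 0" if "f x \<noteq> 0" for x
    using add_mult_div_not_nonpos[OF less wle[OF that]] Fw[OF that] that by auto
  \<comment> \<open>The value at a zero is the limit of the quotient: both \<open>f (L y)\<close>
    and \<open>F y\<close> are to first order multiples of \<open>A (y - x)\<close>, with
    coefficients \<open>deriv f (L x)\<close> and \<open>deriv f x\<close>.\<close>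
  define \<rho> where "\<rho> x = (if f x = 0 then deriv f (L x) / deriv f x else f (L x) / F x)" for x
  have \<rho>0: "\<rho> x \<noteq> 0" for x
    using simple[of x] simple[of "L x"] zeros[of x] F0[of x] by (auto simp: \<rho>_def L_def)
  have "isCont \<rho> x" for x
  proof (cases "f x = 0")
    case False
    have "continuous_on Z (\<lambda>x. f (L x) / F x)"
      using F0 by (intro continuous_intros continuous_on_compose2[OF contf contL[THEN continuous_on_subset]]
          continuous_on_subset[OF contF]) (auto simp: Z_def)
    then have "continuous_on Z \<rho>"
      by (rule continuous_on_eq) (simp add: Z_def \<rho>_def)
    then show ?thesis using False openZ by (simp add: continuous_on_eq_continuous_at Z_def)
  next
    case True
    then have a: "deriv f x \<noteq> 0" by (rule simple)
    have fL: "f (L x) = 0" using zeros True by (simp add: L_def)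
    have der: "(f has_field_derivative deriv f y) (at y)" for y
      using hol by (intro holomorphic_derivI[of f UNIV]) auto
    define p where "p = (\<lambda>y. f y / (y - x))"
    \<comment> \<open>This carries the direction dependence: \<open>A (y - x)\<close> is
      \<open>y - x\<close> times \<open>\<alpha> + \<beta> * \<omega> y\<close>. It has no limit at
      \<open>x\<close> but is bounded by 1.\<close>
    define \<omega> where "\<omega> y = cnj (y - x) / (y - x)" for y
    have p: "p \<midarrow>x\<rightarrow> deriv f x"
      using der[of x] True by (simp add: has_field_derivative_iff p_def)
    have ev: "eventually (\<lambda>y. y \<noteq> x) (at x)" by (simp add: eventually_at_filter)
    have Au: "matrix_act A (y - x) = (y - x) * (\<alpha> + \<beta> * \<omega> y)" if "y \<noteq> x" for y
      using that by (simp add: A \<omega>_def field_simps)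
    have \<omega>1: "norm (\<omega> y) \<le> 1" for y by (simp add: \<omega>_def norm_divide del: complex_cnj_diff)
    have c0: "\<alpha> + \<beta> * \<omega> y \<noteq> 0" for y
      using add_mult_div_not_nonpos[OF less \<omega>1[of y]] by auto
    have LL: "L y - L x = matrix_act A (y - x)" for y by (simp add: L_def matrix_act_diff)
    \<comment> \<open>\<open>L y\<close> differs from \<open>L x\<close> for
      \<open>y \<noteq> x\<close>, so the difference quotient of \<open>f\<close> at
      \<open>L x\<close> may be composed with \<open>L\<close>.\<close>
    have "filterlim L (at (L x)) (at x)"
      unfolding filterlim_at
    proof
      show "\<forall>\<^sub>F y in at x. L y \<in> UNIV \<and> L y \<noteq> L x"
        using ev by eventually_elim (use LL Au c0 in \<open>metis UNIV_I eq_iff_diff_eq_0 mult_eq_0_iff\<close>)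
      show "L \<midarrow>x\<rightarrow> L x" using contL by (simp add: continuous_on_eq_continuous_at isCont_def)
    qed
    moreover have "(\<lambda>y. f y / (y - L x)) \<midarrow>L x\<rightarrow> deriv f (L x)"
      using der[of "L x"] fL by (simp add: has_field_derivative_iff)
    ultimately have q: "(\<lambda>y. f (L y) / (L y - L x)) \<midarrow>x\<rightarrow> deriv f (L x)"
      by (rule filterlim_compose[rotated])
    \<comment> \<open>\<open>H\<close> compares \<open>F\<close> with the increment of
      \<open>L\<close>. Its limit \<open>deriv f x\<close> is obtained by showing that it differs
      from the difference quotient \<open>p\<close> by a term tending to 0.\<close>
    define H where "H y = F y / (L y - L x)" for y
    have "r \<midarrow>x\<rightarrow> r x" using contr by (simp add: continuous_on_eq_continuous_at isCont_def)
    then have rlim: "(\<lambda>y. cnj (p y) * r y - p y) \<midarrow>x\<rightarrow> cnj (deriv f x) * r x - deriv f x"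
      by (intro tendsto_intros p)
    have "r x = (deriv f x)\<^sup>2 / (deriv f x * cnj (deriv f x))"
      by (simp add: r_def True complex_norm_square del: of_real_power)
    then have "cnj (deriv f x) * r x - deriv f x = 0"
      using a by (simp add: power2_eq_square)
    with rlim have 0: "(\<lambda>y. cnj (p y) * r y - p y) \<midarrow>x\<rightarrow> 0" by simp
    have Hp: "H y - p y = \<beta> * \<omega> y * (cnj (p y) * r y - p y) / (\<alpha> + \<beta> * \<omega> y)" if y: "y \<noteq> x" for y
    proof -
      have f: "f y = (y - x) * p y" and cn: "cnj (y - x) = (y - x) * \<omega> y"
        using y by (simp_all add: p_def \<omega>_def)
      have "F y = (y - x) * (\<alpha> * p y + \<beta> * \<omega> y * cnj (p y) * r y)"
        unfolding F_def f complex_cnj_mult cn by (simp add: algebra_simps)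
      then have "H y = (\<alpha> * p y + \<beta> * \<omega> y * cnj (p y) * r y) / (\<alpha> + \<beta> * \<omega> y)"
        using y by (simp add: H_def LL Au)
      then show ?thesis using c0[of y] by (simp add: field_simps)
    qed
    \<comment> \<open>The factor with \<open>\<omega>\<close> has no limit in general, but its norm
      is at most \<open>norm \<beta> / (norm \<alpha> - norm \<beta>)\<close>; the remaining factor
      tends to 0.\<close>
    have "(\<lambda>y. H y - p y) \<midarrow>x\<rightarrow> 0"
    proof (rule tendsto_0_le[OF 0, where K = "norm \<beta> / (norm \<alpha> - norm \<beta>)"])
      show "\<forall>\<^sub>F y in at x. norm (H y - p y) \<le>
          norm (cnj (p y) * r y - p y) * (norm \<beta> / (norm \<alpha> - norm \<beta>))"
        using ev
      proof eventually_elim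
        case (elim y)
        have "norm (\<beta> * \<omega> y) \<le> norm \<beta>" using \<omega>1[of y] by (simp add: norm_mult mult_left_le)
        then have "norm (\<beta> * \<omega> y) / norm (\<alpha> + \<beta> * \<omega> y) \<le> norm \<beta> / (norm \<alpha> - norm \<beta>)"
          using less norm_diff_ineq[of \<alpha> "\<beta> * \<omega> y"] by (intro frac_le) auto
        from mult_left_mono[OF this norm_ge_zero[of "cnj (p y) * r y - p y"]]
        show ?case unfolding Hp[OF elim] by (simp add: norm_mult norm_divide mult_ac)
      qed
    qed
    from tendsto_add[OF this p] have H: "H \<midarrow>x\<rightarrow> deriv f x" by simp
    have "(\<lambda>y. f (L y) / (L y - L x) / H y) \<midarrow>x\<rightarrow> deriv f (L x) / deriv f x"
      by (rule tendsto_divide[OF q H a])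
    \<comment> \<open>The zero is isolated: \<open>p\<close> stays nonzero near \<open>x\<close>, so
      \<open>\<rho>\<close> is given by its quotient branch there.\<close>
    moreover have "\<forall>\<^sub>F y in at x. f (L y) / (L y - L x) / H y = \<rho> y"
      using tendsto_imp_eventually_ne[OF p a] ev
    proof eventually_elim
      case (elim y)
      then have "L y \<noteq> L x" using LL Au c0 by (metis eq_iff_diff_eq_0 mult_eq_0_iff)
      with elim show ?case by (auto simp: \<rho>_def H_def p_def)
    qed
    ultimately have "\<rho> \<midarrow>x\<rightarrow> deriv f (L x) / deriv f x"
      by (rule Lim_transform_eventually)
    then show ?thesis using True by (simp add: isCont_def \<rho>_def)
  qed
  then have "continuous_on UNIV \<rho>" by (simp add: continuous_on_eq_continuous_at)
  \<comment> \<open>The plane is contractible, so the zero-free continuous function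
    \<open>\<rho>\<close> has a global logarithm.\<close>
  then obtain G where G: "continuous_on UNIV G" "\<And>x. \<rho> x = exp (G x)"
    using continuous_logarithm_on_contractible[of UNIV \<rho>] \<rho>0 contractible_UNIV by (metis UNIV_I)
  \<comment> \<open>The exponent sums logarithms of \<open>\<rho>\<close> and of
    \<open>F / f\<close>. Splitting off \<open>Ln \<alpha>\<close> keeps the last argument off the
    branch cut of \<open>Ln\<close>.\<close>
  define g where "g x = exp ((G x + Ln \<alpha> + Ln ((\<alpha> + \<beta> * w x) / \<alpha>)) / of_nat n)" for x
  show ?thesis
  proof
    show "continuous_on {x. f x \<noteq> 0} g"
      unfolding g_def Z_def[symmetric]
      by (intro continuous_intros continuous_on_subset[OF G(1)] contw add_mult_div_not_nonpos less wle)
        (use n \<alpha> in \<open>auto simp: Z_def\<close>)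
    fix x assume x: "f x \<noteq> 0"
    have "g x ^ n = exp (G x + Ln \<alpha> + Ln ((\<alpha> + \<beta> * w x) / \<alpha>))"
      using n by (simp add: g_def flip: exp_of_nat_mult)
    also have "\<dots> = \<rho> x * (\<alpha> + \<beta> * w x)"
    proof -
      have "(\<alpha> + \<beta> * w x) / \<alpha> \<noteq> 0" using add_mult_div_not_nonpos[OF less wle[OF x]] by auto
      with \<alpha> show ?thesis by (simp only: exp_add exp_Ln G(2)) simp
    qed
    also have "\<dots> = f (L x) / f x"
      using x F0[OF x] by (simp add: \<rho>_def flip: Fw)
    finally show "g x ^ n * f x = f (matrix_act A x + t)" using x by (simp add: L_def)
  qed
qed

section \<open>Lifting affine maps to the curve\<close>

text \<open>Over a zero of \<open>f\<close> the fibre of the curve is the single point with second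
  coordinate 0, and the root \<open>g\<close> is not controlled there; hence the separate
  branch.\<close>

definition curve_lift ::
  "(complex \<Rightarrow> complex) \<Rightarrow> (complex \<Rightarrow> complex) \<Rightarrow> (complex \<Rightarrow> complex) \<Rightarrow> complex \<times> complex \<Rightarrow> complex \<times> complex"
  where "curve_lift f L g = (\<lambda>(x, w). (L x, if f x = 0 then 0 else w * g x))"

lemma curve_lift_in_superelliptic_set:
  assumes "n > 0" "p \<in> superelliptic_set n f"
    and "\<And>x. f x \<noteq> 0 \<Longrightarrow> g x ^ n * f x = f (L x)" "\<And>x. f x = 0 \<Longrightarrow> f (L x) = 0"
  shows "curve_lift f L g p \<in> superelliptic_set n f"
  using assms by (auto simp: superelliptic_set_def curve_lift_def power_mult_distrib mult.commute)

text \<open>Off the zeros this is continuity of \<open>g\<close>. At a zero no bound on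
  \<open>g\<close> enters: on the curve the \<open>n\<close>-th power of the second coordinate of
  the lift is \<open>f (L x)\<close>, which tends to 0.\<close>

lemma continuous_on_curve_lift:
  assumes n: "n > 0" and contf: "continuous_on UNIV f" and contL: "continuous_on UNIV L"
    and contg: "continuous_on {x. f x \<noteq> 0} g"
    and g: "\<And>x. f x \<noteq> 0 \<Longrightarrow> g x ^ n * f x = f (L x)" and zero: "\<And>x. f x = 0 \<Longrightarrow> f (L x) = 0"
  shows "continuous_on (superelliptic_set n f) (curve_lift f L g)"
proof -
  define h where "h p = snd (curve_lift f L g p)" for p
  have "(h \<longlongrightarrow> h p) (at p within superelliptic_set n f)" if p: "p \<in> superelliptic_set n f" for p
  proof (cases "f (fst p) = 0")
    case False
    let ?O = "{q. f (fst q) \<noteq> 0} :: (complex \<times> complex) set"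
    have cf: "continuous_on UNIV (\<lambda>q :: complex \<times> complex. f (fst q))"
      by (intro continuous_on_compose2[OF contf] continuous_intros) auto
    have "open ?O" by (intro open_Collect_neq cf continuous_intros)
    moreover have "continuous_on ?O (\<lambda>q. snd q * g (fst q))"
      by (intro continuous_intros continuous_on_compose2[OF contg]) auto
    then have "continuous_on ?O h"
      by (rule continuous_on_eq) (auto simp: h_def curve_lift_def split: prod.splits)
    ultimately have "\<forall>q\<in>?O. isCont h q" by (simp only: continuous_on_eq_continuous_at)
    then have "isCont h p" using False by blast
    then show ?thesis by (simp add: isCont_def tendsto_within_subset[of _ _ _ UNIV])
  next
    case True
    have norm_h: "root n (norm (f (L (fst q)))) = norm (h q)" if "q \<in> superelliptic_set n f" for q
    proof -
      have "curve_lift f L g q \<in> superelliptic_set n f"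
        using n that g zero by (rule curve_lift_in_superelliptic_set)
      then have "h q ^ n = f (L (fst q))"
        by (auto simp: h_def superelliptic_set_def curve_lift_def split: prod.splits)
      then have "norm (f (L (fst q))) = norm (h q) ^ n" by (metis norm_power)
      then show ?thesis using n by (simp add: real_root_power_cancel)
    qed
    have "continuous_on UNIV (\<lambda>q :: complex \<times> complex. f (L (fst q)))"
      by (intro continuous_on_compose2[OF contf] continuous_on_compose2[OF contL] continuous_intros) auto
    then have "((\<lambda>q. f (L (fst q))) \<longlongrightarrow> f (L (fst p))) (at p)"
      unfolding continuous_on_def by blast
    then have "((\<lambda>q. f (L (fst q))) \<longlongrightarrow> f (L (fst p))) (at p within superelliptic_set n f)"
      by (rule tendsto_within_subset) simp
    then have "((\<lambda>q. root n (norm (f (L (fst q))))) \<longlongrightarrow> root n (norm (f (L (fst p)))))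
        (at p within superelliptic_set n f)"
      by (intro tendsto_intros)
    then have "((\<lambda>q. root n (norm (f (L (fst q))))) \<longlongrightarrow> 0) (at p within superelliptic_set n f)"
      using zero[OF True] by simp
    moreover have "\<forall>\<^sub>F q in at p within superelliptic_set n f.
        root n (norm (f (L (fst q)))) = norm (h q)"
      using norm_h by (simp add: eventually_at_filter)
    ultimately have "((\<lambda>q. norm (h q)) \<longlongrightarrow> 0) (at p within superelliptic_set n f)"
      by (rule Lim_transform_eventually)
    then have "(h \<longlongrightarrow> 0) (at p within superelliptic_set n f)" by (rule tendsto_norm_zero_cancel)
    moreover have "h p = 0" using True by (cases p) (simp add: h_def curve_lift_def)
    ultimately show ?thesis by simp
  qed
  then have "continuous_on (superelliptic_set n f) h" by (simp add: continuous_on_def)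
  then have "continuous_on (superelliptic_set n f) (\<lambda>p. (L (fst p), h p))"
    by (intro continuous_on_Pair continuous_on_compose2[OF contL] continuous_intros) auto
  moreover have "curve_lift f L g = (\<lambda>p. (L (fst p), h p))"
    by (auto simp: h_def curve_lift_def fun_eq_iff)
  ultimately show ?thesis by simp
qed

text \<open>Over a zero of \<open>f\<close> the curve forces the second coordinate to be 0;
  elsewhere the two fibre factors cancel.\<close>

lemma curve_lift_inverse:
  assumes "p \<in> superelliptic_set n f" "n > 0" "L' (L (fst p)) = fst p"
    and "\<And>x. f (L x) = 0 \<longleftrightarrow> f x = 0" "\<And>x. f x \<noteq> 0 \<Longrightarrow> g' (L x) * g x = 1"
  shows "curve_lift f L' g' (curve_lift f L g p) = p"
  using assms by (auto simp: superelliptic_set_def curve_lift_def mult.commute mult.left_commute)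

section \<open>Elements of the Veech group of the curve\<close>

lemma charts_superelliptic_curve:
  assumes "(U, \<phi>) \<in> charts (superelliptic_curve n z f)"
  shows "\<phi> = fst"
  using assms by (auto simp: superelliptic_curve_def pullback_charts_def punctured_plane_def)

lemma range_compl_nonempty:
  fixes z :: "nat \<Rightarrow> complex"
  shows "- range z \<noteq> {}"
proof
  assume "- range z = {}"
  then have "range z = UNIV" by blast
  moreover have "countable (range z)" by simp
  ultimately show False using uncountable_UNIV_complex by simp
qed

context
  fixes z :: "nat \<Rightarrow> complex" and f :: "complex \<Rightarrow> complex" and n :: nat
  assumes inj: "inj z" and lim: "filterlim (\<lambda>k. norm (z k)) at_top sequentially"
    and f: "weierstrass_map z f" and n: "n \<ge> 2"
begin

lemma regular_points_superelliptic_curve: "regular_points (superelliptic_curve n z f) \<noteq> {}"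
proof -
  obtain x where x: "x \<notin> range z" using range_compl_nonempty[of z] by blast
  then have "f x \<noteq> 0" using weierstrass_map_zero_iff[OF f] by blast
  then have "exp (Ln (f x) / of_nat n) ^ n = f x" using n by (simp flip: exp_of_nat_mult)
  with x have "(x, exp (Ln (f x) / of_nat n)) \<in> regular_points (superelliptic_curve n z f)"
    by (auto simp: regular_points_def superelliptic_curve_def superelliptic_set_def)
  then show ?thesis by blast
qed

text \<open>The affine map and its inverse both lift, with mutually inverse lifts. The first
  coordinate of the lift is the affine map itself, so its differential is \<open>A\<close>.\<close>

lemma affine_in_veech_group_superelliptic_curve:
  assumes det: "det A > 0" and perm: "\<And>x. matrix_act A x + t \<in> range z \<longleftrightarrow> x \<in> range z"
  shows "A \<in> carrier (veech_group (superelliptic_curve n z f))"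
proof -
  let ?S = "superelliptic_curve n z f" and ?P = "superelliptic_set n f"
  have S: "translation_surface ?S" by (rule translation_surface_superelliptic_curve[OF lim f n])
  have P: "points ?S = ?P" and C: "cone_points ?S = range (\<lambda>k. (z k, 0))"
    by (simp_all add: superelliptic_curve_def)
  have n0: "n > 0" using n by simp
  note f0 = weierstrass_map_zero_iff[OF f] and hol = weierstrass_map_holomorphic[OF f]
  have contf: "continuous_on UNIV f" by (rule holomorphic_on_imp_continuous_on[OF hol])
  have simple: "deriv f x \<noteq> 0" if "f x = 0" for x
    using that weierstrass_map_simple_zero[OF inj f] unfolding f0 by auto
  define L where "L x = matrix_act A x + t" for x
  have zero: "f (L x) = 0 \<longleftrightarrow> f x = 0" for x by (simp add: f0 perm L_def)
  have contL: "continuous_on UNIV L" unfolding L_def by (intro continuous_intros)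
  obtain B where B: "A ** B = mat 1" "B ** A = mat 1" using det_pos_inverse[OF det] by blast
  define L' where "L' y = matrix_act B (y - t)" for y
  have L'L: "L' (L x) = x" for x
    by (simp add: L_def L'_def B matrix_act_one flip: matrix_act_mult)
  have LL': "L (L' x) = x" for x
    by (simp add: L_def L'_def B matrix_act_one flip: matrix_act_mult)
  have zero': "f (L' x) = 0 \<longleftrightarrow> f x = 0" for x using zero[of "L' x"] by (simp add: LL')
  have contL': "continuous_on UNIV L'" unfolding L'_def by (intro continuous_intros)
  obtain g where contg: "continuous_on {x. f x \<noteq> 0} g"
    and g: "\<And>x. f x \<noteq> 0 \<Longrightarrow> g x ^ n * f x = f (L x)"
    using affine_root_of_quotient[OF hol simple det zero[unfolded L_def] n0] unfolding L_def by blast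
  have g0: "g x \<noteq> 0" if "f x \<noteq> 0" for x using g[OF that] zero[of x] that n0 by (auto simp: power_0_left)
  \<comment> \<open>Chosen so that \<open>g' (L x) * g x = 1\<close>, which makes the lift of
    \<open>L'\<close> inverse to the lift of \<open>L\<close>.\<close>
  define g' where "g' y = inverse (g (L' y))" for y
  have contg': "continuous_on {x. f x \<noteq> 0} g'" unfolding g'_def
    by (intro continuous_intros continuous_on_compose2[OF contg] continuous_on_subset[OF contL'])
      (use g0 zero' in auto)
  have g': "g' x ^ n * f x = f (L' x)" if "f x \<noteq> 0" for x
    using g[of "L' x"] g0[of "L' x"] that zero'[of x] by (simp add: g'_def LL' field_simps)
  let ?T = "curve_lift f L g" and ?T' = "curve_lift f L' g'"
  have cT: "continuous_on ?P ?T"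
    by (rule continuous_on_curve_lift[OF n0 contf contL contg g]) (simp_all add: zero)
  have mT: "?T p \<in> ?P" if "p \<in> ?P" for p
    by (rule curve_lift_in_superelliptic_set[OF n0 that g]) (simp_all add: zero)
  have cT': "continuous_on ?P ?T'"
    by (rule continuous_on_curve_lift[OF n0 contf contL' contg' g']) (simp_all add: zero')
  have mT': "?T' p \<in> ?P" if "p \<in> ?P" for p
    by (rule curve_lift_in_superelliptic_set[OF n0 that g']) (simp_all add: zero')
  have hom: "homeomorphism (points ?S) (points ?S) ?T ?T'"
    unfolding P
  proof (rule homeomorphismI[OF cT cT'])
    show "?T' (?T p) = p" if "p \<in> ?P" for p
      by (rule curve_lift_inverse) (use that n0 in \<open>simp_all add: L'L zero g'_def g0\<close>)
    show "?T (?T' p) = p" if "p \<in> ?P" for p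
      by (rule curve_lift_inverse) (use that n0 in \<open>simp_all add: LL' zero' g'_def g0\<close>)
  qed (use mT mT' in auto)
  have cone: "?T ` cone_points ?S = cone_points ?S"
  proof -
    have Z: "range (\<lambda>k. (z k, 0::complex)) = (\<lambda>x. (x, 0)) ` range z" by (simp add: image_image)
    have "?T ` (\<lambda>x. (x, 0)) ` range z = (\<lambda>x. (x, 0)) ` L ` range z"
      by (simp add: image_image curve_lift_def cong: if_cong)
    also have "L ` range z = range z"
    proof
      show "L ` range z \<subseteq> range z" using perm by (auto simp: L_def)
      show "range z \<subseteq> L ` range z"
      proof
        fix x assume "x \<in> range z"
        \<comment> \<open>The equivalence for zeros also holds for the inverse map, so every zero is
          the image of a zero.\<close>
        then have "L' x \<in> range z" using zero'[of x] by (simp add: f0)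
        then show "x \<in> L ` range z" using LL'[of x] by (metis imageI)
      qed
    qed
    finally show ?thesis unfolding C Z .
  qed
  have hd: "has_differential ?S ?T A"
    unfolding has_differential_def
  proof (intro ballI has_differential_atI)
    fix p U \<phi> V \<psi>
    assume U: "(U, \<phi>) \<in> charts ?S" and V: "(V, \<psi>) \<in> charts ?S" and p: "p \<in> U" "?T p \<in> V"
    have "U \<subseteq> ?P" using chart_open(2)[OF S U] by (simp add: P)
    moreover have "openin (top_of_set ?P) V" using chart_open(1)[OF S V] by (simp add: P)
    ultimately have "openin (top_of_set U) (U \<inter> ?T -` V)"
      using continuous_on_subset[OF cT] mT by (intro continuous_openin_preimage[of U ?T ?P V]) auto
    \<comment> \<open>Every chart of the curve is a restriction of \<open>fst\<close>, so one
      translation part \<open>t\<close> serves for all pairs of charts.\<close>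
    moreover have "fst (?T q) = matrix_act A (fst q) + t" for q
      by (simp add: curve_lift_def L_def split: prod.splits)
    ultimately show "\<exists>t W. openin (top_of_set U) W \<and> p \<in> W \<and> ?T ` W \<subseteq> V \<and>
        (\<forall>q\<in>W. \<psi> (?T q) = matrix_act A (\<phi> q) + t)"
      unfolding charts_superelliptic_curve[OF U] charts_superelliptic_curve[OF V]
      using p by (intro exI[of _ t] exI[of _ "U \<inter> ?T -` V"]) auto
  qed
  have "?T \<in> Aff_plus ?S" by (rule Aff_plusI[OF S hom cone hd det])
  with hd show ?thesis by (auto simp: carrier_veech_group)
qed

end

text \<open>The difference of \<open>T\<close> and its linear part is locally constant on a
  connected set, so \<open>T\<close> is globally affine there. As it maps the complement of the
  punctures onto itself, the affine extension permutes the punctures.\<close>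

lemma veech_group_punctured_plane_affine:
  assumes A: "A \<in> carrier (veech_group (punctured_plane z))" and det: "det A > 0"
  obtains t where "\<And>x. matrix_act A x + t \<in> range z \<longleftrightarrow> x \<in> range z"
proof -
  let ?S = "punctured_plane z" and ?X = "- range z"
  have P: "points ?S = ?X" "regular_points ?S = ?X" "charts ?S = {(?X, \<lambda>x. x)}"
    by (simp_all add: punctured_plane_def regular_points_def)
  obtain T where T: "T \<in> Aff_plus ?S" "has_differential ?S T A"
    using A by (auto simp: carrier_veech_group)
  obtain h where "homeomorphism ?X ?X T h"
    using T(1) unfolding Aff_plus_def affine_diffeo_def P by blast
  then have im: "T ` ?X = ?X" by (simp add: homeomorphism_def)
  have "(\<lambda>x. T x - matrix_act A x) constant_on ?X"
  proof (rule locally_constant_imp_constant)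
    show "connected ?X"
      \<comment> \<open>Removing countably many points leaves the plane path connected.\<close>
      by (intro path_connected_imp_connected path_connected_complement_countable) auto
    fix p assume p: "p \<in> ?X"
    then have Tp: "T p \<in> ?X" using im by blast
    have "has_differential_at ?S T p A" using T(2) p by (simp add: has_differential_def P)
    then obtain t W where W: "openin (top_of_set ?X) W" "p \<in> W" "T ` W \<subseteq> ?X"
      "\<And>q. q \<in> W \<Longrightarrow> T q = matrix_act A q + t"
      by (rule has_differential_atD[where \<phi> = "\<lambda>x. x" and \<psi> = "\<lambda>x. x" and U = ?X and V = ?X])
        (use p Tp in \<open>simp_all add: P\<close>)
    then show "\<exists>W. openin (top_of_set ?X) W \<and> p \<in> W \<and>
        (\<forall>x\<in>W. T x - matrix_act A x = T p - matrix_act A p)"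
      by (intro exI[of _ W]) auto
  qed
  then obtain t where "\<And>x. x \<in> ?X \<Longrightarrow> T x - matrix_act A x = t"
    unfolding constant_on_def by blast
  then have t: "\<And>x. x \<in> ?X \<Longrightarrow> T x = matrix_act A x + t" by (simp add: diff_eq_eq add.commute)
  obtain B where B: "B ** A = mat 1" using det_pos_inverse[OF det] by blast
  have inj: "x = y" if "matrix_act A x = matrix_act A y" for x y
    using arg_cong[OF that, of "matrix_act B"]
    by (simp add: B matrix_act_one flip: matrix_act_mult)
  have "matrix_act A x + t \<in> ?X \<longleftrightarrow> x \<in> ?X" for x
  proof
    assume "matrix_act A x + t \<in> ?X"
    \<comment> \<open>A value off the punctures is already attained by \<open>T\<close> at a point
      off the punctures, and injectivity of the affine map identifies that point with
      \<open>x\<close>.\<close>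
    then have "matrix_act A x + t \<in> T ` ?X" using im by simp
    then obtain y where "y \<in> ?X" "matrix_act A x + t = T y" by blast
    then show "x \<in> ?X" using t inj[of x y] by simp
  next
    assume "x \<in> ?X"
    then have "T x \<in> ?X" using im by blast
    then show "matrix_act A x + t \<in> ?X" using t[OF \<open>x \<in> ?X\<close>] by simp
  qed
  then show ?thesis by (intro that[of t]) simp
qed

theorem theorem2p8:
  fixes z :: "nat \<Rightarrow> complex" and f :: "complex \<Rightarrow> complex" and n :: nat
  assumes "inj z"
    and "filterlim (\<lambda>k. norm (z k)) at_top sequentially"
    and "weierstrass_map z f"
    and "n \<ge> 2"
  shows "group (veech_group (superelliptic_curve n z f)) \<and>
         subgroup (carrier (veech_group (punctured_plane z)))
                  (veech_group (superelliptic_curve n z f))"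
proof -
  let ?H = "carrier (veech_group (punctured_plane z))"
    and ?K = "carrier (veech_group (superelliptic_curve n z f))"
  have "regular_points (punctured_plane z) \<noteq> {}"
    using range_compl_nonempty[of z] by (simp add: regular_points_def punctured_plane_def)
  then have H: "subgroup ?H GL2_plus"
    by (rule subgroup_veech_group[OF translation_surface_punctured_plane[OF assms(2)]])
  have K: "subgroup ?K GL2_plus"
    by (rule subgroup_veech_group[OF translation_surface_superelliptic_curve[OF assms(2-4)]
          regular_points_superelliptic_curve[OF assms]])
  \<comment> \<open>Both carriers are subgroups of \<open>GL2_plus\<close>, so inclusion of sets
    suffices: a differential on the punctured plane is the linear part of an affine map permuting
    the zeros, and that map lifts.\<close>
  have "?H \<subseteq> ?K"
  proof
    fix A assume A: "A \<in> ?H"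
    then have det: "det A > 0" using subgroup.subset[OF H] by (auto simp: GL2_plus_def)
    obtain t where "\<And>x. matrix_act A x + t \<in> range z \<longleftrightarrow> x \<in> range z"
      using veech_group_punctured_plane_affine[OF A det] by blast
    with assms det show "A \<in> ?K" by (rule affine_in_veech_group_superelliptic_curve)
  qed
  then have "subgroup ?H (GL2_plus\<lparr>carrier := ?K\<rparr>)"
    by (rule group.subgroup_incl[OF group_GL2_plus H K])
  moreover have "group (GL2_plus\<lparr>carrier := ?K\<rparr>)"
    by (rule subgroup.subgroup_is_group[OF K group_GL2_plus])
  ultimately show ?thesis by (simp flip: veech_group_eq)
qed

end
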